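(* Let $H$ be a finite-dimensional real Hilbert space, $m \ge 1$, and $\boldsymbol{H} = H \oplus \cdots \oplus H$ ($m+1$ copies). Let $\boldsymbol{A}, \boldsymbol{B} : \boldsymbol{H} \to \boldsymbol{H}$ be constant linear operators with $\boldsymbol{B} = \boldsymbol{B}^* > 0$ and $\boldsymbol{A} \ge 0$, and suppose that $$\boldsymbol{A} = \sum_{\gamma=1}^{d} \boldsymbol{A}_\gamma, \qquad \boldsymbol{A}_\gamma \ge 0, \quad \gamma = 1,2,\ldots,d .$$ Let $u^0 \in H$ and $\boldsymbol{u}^0 = \{u^0,0,\ldots,0\} \in \boldsymbol{H}$. Consider the component-wise splitting scheme with constant weight $\sigma$ and time step $\tau > 0$, $$\boldsymbol{B}\, \frac{\boldsymbol{y}^{n+\gamma/d} - \boldsymbol{y}^{n+(\gamma-1)/d}}{\tau} + \boldsymbol{A}_\gamma \big(\sigma \boldsymbol{y}^{n+\gamma/d} + (1-\sigma)\boldsymbol{y}^{n+(\gamma-1)/d}\big) = 0, \quad \gamma = 1,2,\ldots,d, \quad n = 0,1,\ldots,N-1,$$ with $\boldsymbol{y}^0 = \boldsymbol{u}^0$. If $\sigma \ge 1/2$, then the scheme is unconditionally stable in $\boldsymbol{H}_{\boldsymbol{B}}$: for every $\tau > 0$ and every $N \ge 1$, any solution of the scheme satisfies $$\|\boldsymbol{y}^{n+1}\|_{\boldsymbol{B}}^2 \le \|\boldsymbol{u}^0\|_{\boldsymbol{B}}^2, \qquad n = 0,1,\ldots,N-1.$$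
   Context: In $\boldsymbol{H}$, for $\boldsymbol{u} = \{u,u_1,\ldots,u_m\}$ and $\boldsymbol{v} = \{v,v_1,\ldots,v_m\}$, the inner product is $(\boldsymbol{u},\boldsymbol{v}) = (u,v) + \sum_{i=1}^m (u_i,v_i)$. For a (not necessarily self-adjoint) operator, $\boldsymbol{A} \ge 0$ means $(\boldsymbol{A}\boldsymbol{v},\boldsymbol{v}) \ge 0$ for all $\boldsymbol{v}$; $\boldsymbol{B} > 0$ means $(\boldsymbol{B}\boldsymbol{v},\boldsymbol{v}) > 0$ for all $\boldsymbol{v} \ne 0$. For $\boldsymbol{B} = \boldsymbol{B}^* > 0$, $\boldsymbol{H}_{\boldsymbol{B}}$ is $\boldsymbol{H}$ with the norm $\|\boldsymbol{v}\|_{\boldsymbol{B}} = (\boldsymbol{B}\boldsymbol{v},\boldsymbol{v})^{1/2}$. The vectors $\boldsymbol{y}^{n+\gamma/d} \in \boldsymbol{H}$, $\gamma = 1,\ldots,d$, are successive intermediate values, the last one ($\gamma=d$) being $\boldsymbol{y}^{n+1}$. "Unconditionally stable" means that the stated estimate holds with no restriction on $\tau > 0$. *)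

theory Defs
  imports "HOL-Analysis.Analysis"
begin

text \<open>
  The space of vectors \<open>{v, v\<^sub>1, \<dots>, v\<^sub>m}\<close>, i.e. the direct sum of \<open>m + 1\<close> copies of \<open>'a\<close>
  with \<open>m = CARD('m)\<close>, which is at least 1 because types are inhabited.  The library inner product
  on this type is \<open>(u, v) \<bullet> (u', v') = u \<bullet> u' + (\<Sum>i\<in>UNIV. v $ i \<bullet> v' $ i)\<close>.
\<close>
type_synonym ('a, 'm) multi = "'a \<times> ('a ^ 'm)"

text \<open>No symmetry is required in the two sign conditions.\<close>

definition op_nonneg :: "('v::real_inner \<Rightarrow> 'v) \<Rightarrow> bool" where
  "op_nonneg A \<longleftrightarrow> (\<forall>v. A v \<bullet> v \<ge> 0)"

definition op_pos :: "('v::real_inner \<Rightarrow> 'v) \<Rightarrow> bool" where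
  "op_pos B \<longleftrightarrow> (\<forall>v. v \<noteq> 0 \<longrightarrow> B v \<bullet> v > 0)"

definition op_norm :: "('v::real_inner \<Rightarrow> 'v) \<Rightarrow> 'v \<Rightarrow> real" where
  "op_norm B v = sqrt (B v \<bullet> v)"

text \<open>
  The time levels \<open>n + \<gamma>/d\<close> are the multiples of \<open>1/d\<close>: \<open>y k\<close> stands for the approximation at
  level \<open>k/d\<close>, so \<open>y (n * d + \<gamma>)\<close> is the one at level \<open>n + \<gamma>/d\<close>, and \<open>\<gamma> = d\<close> gives level \<open>n + 1\<close>.
\<close>
definition splitting_scheme ::
  "('v::real_inner \<Rightarrow> 'v) \<Rightarrow> (nat \<Rightarrow> 'v \<Rightarrow> 'v) \<Rightarrow> nat \<Rightarrow> real \<Rightarrow> real \<Rightarrow> nat \<Rightarrow> 'v \<Rightarrow> (nat \<Rightarrow> 'v) \<Rightarrow> bool"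
where
  "splitting_scheme B A\<^sub>s d \<sigma> \<tau> N y\<^sub>0 y \<longleftrightarrow>
     y 0 = y\<^sub>0 \<and>
     (\<forall>n<N. \<forall>\<gamma>\<in>{1..d}.
        B ((y (n * d + \<gamma>) - y (n * d + (\<gamma> - 1))) /\<^sub>R \<tau>)
        + A\<^sub>s \<gamma> (\<sigma> *\<^sub>R y (n * d + \<gamma>) + (1 - \<sigma>) *\<^sub>R y (n * d + (\<gamma> - 1))) = 0)"

end

theory Submission
  imports Defs
begin

text \<open>
  Pairing a substep with its weighted value \<open>u = \<sigma> y' + (1 - \<sigma>) y\<close> gives
  \<open>B (y' - y) \<bullet> u = - \<tau> (A\<^sub>\<gamma> u \<bullet> u) \<le> 0\<close>. Since \<open>u = (y' + y) / 2 + (\<sigma> - 1/2) (y' - y)\<close> and \<open>B\<close> is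
  symmetric, the left side is half the increment of \<open>B y \<bullet> y\<close> plus a nonnegative term, so the energy
  \<open>B y \<bullet> y\<close> decreases in every substep.

  The library's \<^const>\<open>adjoint\<close> is a Hilbert choice and carries information only if some adjoint
  exists, which the library proves for Euclidean spaces only. Existence is obtained here from a
  representation theorem for linear functionals on the span of a finite set.
\<close>

text \<open>Gram-Schmidt by induction on \<open>S\<close>, with \<open>f\<close> arbitrary so that
  the hypothesis serves twice. Applied to \<open>a \<bullet> x\<close> it gives the orthogonal
  projection \<open>p\<close> of \<open>a\<close> onto \<open>span S\<close>; applied to
  \<open>f\<close> it gives the representing vector on \<open>span S\<close>. A multiple of
  \<open>b = a - p\<close> then corrects the value at \<open>b\<close> without changing those on
  \<open>span S\<close>.\<close>

lemma riesz_span: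
  fixes f :: "'v::real_inner \<Rightarrow> real"
  assumes "finite S" and "linear f"
  shows "\<exists>w\<in>span S. \<forall>x\<in>span S. f x = w \<bullet> x"
  using assms
proof (induction S arbitrary: f rule: finite_induct)
  case empty
  then show ?case by (auto simp: linear_0)
next
  case (insert a S)
  have "linear (\<lambda>x. a \<bullet> x)"
    by (simp add: bounded_linear.linear bounded_linear_inner_right)
  with insert.IH obtain p where p: "p \<in> span S" "\<And>x. x \<in> span S \<Longrightarrow> a \<bullet> x = p \<bullet> x"
    by metis
  from insert.IH[OF insert.prems] obtain w where
    w: "w \<in> span S" "\<And>x. x \<in> span S \<Longrightarrow> f x = w \<bullet> x"
    by metis
  interpret f: linear f by fact
  define b where "b = a - p"
  \<comment> \<open>The choice forces \<open>c * (b \<bullet> b) = f b\<close>. If \<open>a\<close>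
    already lies in \<open>span S\<close>, then \<open>b = 0\<close> and both sides vanish.\<close>
  define c where "c = f b / (b \<bullet> b)"
  have orth: "b \<bullet> x = 0" if "x \<in> span S" for x
    using p(2)[OF that] by (simp add: b_def inner_diff_left)
  have sub: "span S \<subseteq> span (insert a S)"
    by (rule span_mono) auto
  have "w + c *\<^sub>R b \<in> span (insert a S)"
    using sub w(1) p(1) unfolding b_def
    by (intro span_add span_scale span_diff) (auto intro: span_base)
  moreover have "f x = (w + c *\<^sub>R b) \<bullet> x" if "x \<in> span (insert a S)" for x
  proof -
    from that obtain k where "x - k *\<^sub>R a \<in> span S"
      by (auto simp: span_insert)
    \<comment> \<open>Here \<open>x - k b = (x - k a) + k p\<close>, a sum of two elements of
      \<open>span S\<close>.\<close>
    then have z: "x - k *\<^sub>R b \<in> span S"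
      using span_add[OF _ span_scale[OF p(1), of k]] by (fastforce simp: b_def algebra_simps)
    define z where "z = x - k *\<^sub>R b"
    have x: "x = z + k *\<^sub>R b" and "z \<in> span S"
      using z by (auto simp: z_def)
    have "f b = c * (b \<bullet> b)"
      by (cases "b = 0") (auto simp: c_def f.zero)
    moreover have "w \<bullet> b = 0"
      using orth[OF w(1)] by (simp add: inner_commute)
    ultimately show ?thesis
      using w(2)[OF \<open>z \<in> span S\<close>] orth[OF \<open>z \<in> span S\<close>]
      by (simp add: x f.add f.scale inner_add_left inner_add_right)
  qed
  ultimately show ?case by blast
qed

text \<open>The vectors representing the functionals \<open>f x \<bullet> y\<close> of
  \<open>x\<close>, one for each \<open>y\<close>, form a witness for the choice in
  \<open>adjoint\<close>.\<close>

lemma adjoint_works_finite_span: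
  fixes f :: "'v::real_inner \<Rightarrow> 'w::real_inner" and S :: "'v set"
  assumes "finite S" and "span S = UNIV" and "linear f"
  shows "f x \<bullet> y = x \<bullet> adjoint f y"
proof -
  have "\<exists>w. \<forall>x. f x \<bullet> y = w \<bullet> x" for y
  proof -
    have "linear (\<lambda>x. f x \<bullet> y)"
      by (intro linearI) (simp_all add: linear_add[OF assms(3)] linear_scale[OF assms(3)] inner_add_left)
    from riesz_span[OF assms(1) this] show ?thesis
      by (auto simp: assms(2))
  qed
  then obtain g where "\<forall>x y. f x \<bullet> y = x \<bullet> g y"
    by (metis inner_commute)
  then have "\<forall>x y. f x \<bullet> y = x \<bullet> adjoint f y"
    unfolding adjoint_def by (rule someI[of "\<lambda>h. \<forall>x y. f x \<bullet> y = x \<bullet> h y"])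
  then show ?thesis by blast
qed

text \<open>Carries finite dimension from the component space to the product on which
  \<open>B\<close> acts: the generators are copied into each of the slots.\<close>

lemma finite_span_multi:
  assumes "finite S" and "span S = (UNIV :: 'a::real_inner set)"
  shows "\<exists>T :: ('a, 'm::finite) multi set. finite T \<and> span T = UNIV"
proof -
  define f :: "'a \<Rightarrow> ('a, 'm) multi" where "f x = (x, 0)" for x
  define g :: "'m \<Rightarrow> 'a \<Rightarrow> ('a, 'm) multi" where "g i x = (0, axis i x)" for i x
  define T where "T = f ` S \<union> (\<Union>i. g i ` S)"
  have "linear f"
    by (intro linearI) (auto simp: f_def)
  then have f: "f x \<in> span T" for x
    using linear_span_image[of f S] assms(2) span_mono[of "f ` S" T] by (auto simp: T_def)
  have "linear (g i)" for i
    by (intro linearI) (auto simp: g_def axis_def vec_eq_iff)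
  then have g: "g i x \<in> span T" for i x
    using linear_span_image[of "g i" S] assms(2) span_mono[of "g i ` S" T] by (auto simp: T_def)
  have "v \<in> span T" for v
  proof -
    have "v = f (fst v) + (\<Sum>i\<in>UNIV. g i (snd v $ i))"
      by (simp add: f_def g_def prod_eq_iff fst_sum snd_sum vec_eq_iff axis_def if_distrib cong: if_cong)
    also have "\<dots> \<in> span T"
      by (intro span_add span_sum f g)
    finally show ?thesis .
  qed
  moreover have "finite T"
    using assms(1) by (simp add: T_def)
  ultimately show ?thesis by blast
qed

lemma weighted_step_energy_le:
  fixes B A :: "'v::real_inner \<Rightarrow> 'v"
  assumes "linear B" and sym: "\<And>x y. B x \<bullet> y = x \<bullet> B y"
    and B: "op_nonneg B" and A: "op_nonneg A"
    and "\<tau> > 0" and "\<sigma> \<ge> 1/2"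
    and step: "B ((z - y) /\<^sub>R \<tau>) + A (\<sigma> *\<^sub>R z + (1 - \<sigma>) *\<^sub>R y) = 0"
  shows "B z \<bullet> z \<le> B y \<bullet> y"
proof -
  interpret B: linear B by fact
  define u where "u = \<sigma> *\<^sub>R z + (1 - \<sigma>) *\<^sub>R y"
  have "B ((z - y) /\<^sub>R \<tau>) = - A u"
    using step by (simp add: u_def eq_neg_iff_add_eq_0)
  then have "(B (z - y) \<bullet> u) / \<tau> \<le> 0"
    using A by (simp add: B.scale op_nonneg_def divide_inverse_commute flip: inner_scaleR_left)
  then have 1: "B (z - y) \<bullet> u \<le> 0"
    using \<open>\<tau> > 0\<close> by (simp add: divide_le_0_iff)
  have "0 \<le> (2 * \<sigma> - 1) * (B (z - y) \<bullet> (z - y))"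
    using B \<open>\<sigma> \<ge> 1/2\<close> by (simp add: op_nonneg_def)
  \<comment> \<open>Uses \<open>2 u = (z + y) + (2 \<sigma> - 1) (z - y)\<close>; in
    \<open>B (z - y) \<bullet> (z + y)\<close> the cross terms cancel by symmetry of
    \<open>B\<close>.\<close>
  moreover have "2 * (B (z - y) \<bullet> u) = B z \<bullet> z - B y \<bullet> y + (2 * \<sigma> - 1) * (B (z - y) \<bullet> (z - y))"
    using sym[of y z] by (simp add: u_def B.diff inner_simps inner_commute algebra_simps)
  ultimately show ?thesis
    using 1 by linarith
qed

lemma op_pos_imp_op_nonneg: "op_pos B \<Longrightarrow> op_nonneg B"
  unfolding op_pos_def op_nonneg_def by (metis inner_zero_right order_refl less_imp_le)

theorem theorem3:
  fixes A B :: "('a::{real_inner,complete_space}, 'm::finite) multi \<Rightarrow> ('a, 'm) multi"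
    and A\<^sub>s :: "nat \<Rightarrow> ('a, 'm) multi \<Rightarrow> ('a, 'm) multi"
    and d :: nat and \<sigma> :: real and u\<^sub>0 :: 'a
  assumes "\<exists>S::'a set. finite S \<and> span S = UNIV"
    and "linear A" and "linear B"
    and "adjoint B = B" and "op_pos B"
    and "op_nonneg A"
    and "d \<ge> 1"
    and "\<And>\<gamma>. \<gamma> \<in> {1..d} \<Longrightarrow> linear (A\<^sub>s \<gamma>)"
    and "A = (\<lambda>v. \<Sum>\<gamma>=1..d. A\<^sub>s \<gamma> v)"
    and "\<And>\<gamma>. \<gamma> \<in> {1..d} \<Longrightarrow> op_nonneg (A\<^sub>s \<gamma>)"
    and "\<sigma> \<ge> 1/2"
  shows "\<forall>\<tau>>0. \<forall>N\<ge>1. \<forall>y. splitting_scheme B A\<^sub>s d \<sigma> \<tau> N (u\<^sub>0, 0) y \<longrightarrow>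
           (\<forall>n<N. (op_norm B (y ((n + 1) * d)))\<^sup>2 \<le> (op_norm B (u\<^sub>0, 0))\<^sup>2)"
proof (intro allI impI)
  fix \<tau> :: real and N n :: nat and y
  assume "\<tau> > 0" and y: "splitting_scheme B A\<^sub>s d \<sigma> \<tau> N (u\<^sub>0, 0) y" and "n < N"
  obtain T :: "('a, 'm) multi set" where "finite T" "span T = UNIV"
    using assms(1) finite_span_multi by metis
  then have sym: "B v \<bullet> w = v \<bullet> B w" for v w
    using adjoint_works_finite_span[of T B v w] assms(3,4) by simp
  have B: "op_nonneg B"
    using assms(5) by (rule op_pos_imp_op_nonneg)
  have substep: "B (y (Suc k)) \<bullet> y (Suc k) \<le> B (y k) \<bullet> y k" if "k < N * d" for k
  proof -
    \<comment> \<open>The double loop becomes a single chain: the substep from \<open>k\<close> to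
      \<open>Suc k\<close> is the one with \<open>n = k div d\<close> and
      \<open>\<gamma> = Suc (k mod d)\<close>, the shift being due to \<open>\<gamma>\<close>
      starting at 1.\<close>
    have "k div d < N" and "Suc (k mod d) \<in> {1..d}"
      using that assms(7) by (auto simp: less_mult_imp_div_less Suc_le_eq)
    moreover have "k div d * d + Suc (k mod d) = Suc k" "k div d * d + (Suc (k mod d) - 1) = k"
      by simp_all
    ultimately have "B ((y (Suc k) - y k) /\<^sub>R \<tau>)
        + A\<^sub>s (Suc (k mod d)) (\<sigma> *\<^sub>R y (Suc k) + (1 - \<sigma>) *\<^sub>R y k) = 0"
      using y unfolding splitting_scheme_def by metis
    then show ?thesis
      using weighted_step_energy_le[OF assms(3) sym B assms(10) \<open>\<tau> > 0\<close> assms(11)]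
        \<open>Suc (k mod d) \<in> {1..d}\<close> by blast
  qed
  have "B (y k) \<bullet> y k \<le> B (y 0) \<bullet> y 0" if "k \<le> N * d" for k
    using that by (induction k) (auto intro: order_trans[OF substep])
  moreover have "(n + 1) * d \<le> N * d"
    using \<open>n < N\<close> by (intro mult_le_mono1) simp
  moreover have "y 0 = (u\<^sub>0, 0)"
    using y by (simp add: splitting_scheme_def)
  ultimately have "B (y ((n + 1) * d)) \<bullet> y ((n + 1) * d) \<le> B (u\<^sub>0, 0) \<bullet> (u\<^sub>0, 0)"
    by metis
  \<comment> \<open>Nonnegativity of the energy is what lets the square undo the root.\<close>
  moreover have "(op_norm B v)\<^sup>2 = B v \<bullet> v" for v
    using B unfolding op_norm_def op_nonneg_def by (intro real_sqrt_pow2) blast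
  ultimately show "(op_norm B (y ((n + 1) * d)))\<^sup>2 \<le> (op_norm B (u\<^sub>0, 0))\<^sup>2"
    by metis
qed

end
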